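(* Consider the convex optimization problem $\min_{x\in\mathcal{D}} f(x)$ subject to $Ax-b=0$, with $f$, $\mathcal{D}$, $A$, $b$, $f^\epsilon$, $W$ as in the context. Assume $\nabla^2 f(x)-W(x)\succ 0$ for all $x\in\mathcal{D}$ and let $$\bar\epsilon=\min_{x\in\mathcal{D}}\frac{2\lambda_{\min}(AA^\top)\,\lambda_{\min}(\nabla^2 f(x)-W(x))}{\lambda_{\max}^2(\nabla^2 f(x))+R(x)\,\lambda_{\min}(\nabla^2 f(x)-W(x))},$$ where $R(x)=2\lambda_{\max}(\nabla^2 f(x))-\lambda_{\min}(\nabla^2 f(x)-W(x))$. Then $f^\epsilon$ is convex on $\mathcal{D}$ for all $\epsilon\in(0,\bar\epsilon]$ and, consequently, the following convergence guarantee holds: if $f^\epsilon$ has Lipschitz gradient with constant $L$ and Nesterov's iteration (given in the context, with stepsize $\alpha>0$) is initialized at an arbitrary initial condition $x_0$ with $y_0=x_0$ and $a_0=1$, then $$f^\epsilon(x_k)-f^\epsilon(x^* )\le\frac{C}{(k+1)^2},$$ where $x^*\in\mathbb{R}^n$ is a global minimizer of $f^\epsilon$ and $C\ge 0$ is a constant dependent on the initial condition and $L$.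
   Context: Setting: $f:\mathbb{R}^n\to\mathbb{R}$ is convex, twice continuously differentiable and three times differentiable; $\mathcal{D}\subset\mathbb{R}^n$ is a convex compact set that is regular, i.e. equal to the closure of its interior; $A\in\mathbb{R}^{p\times n}$ has full row rank, $p<n$, and $b\in\mathbb{R}^p$. $\lambda_{\min}$, $\lambda_{\max}$ denote the minimum and maximum eigenvalue. Penalty function: for $\epsilon>0$, $$f^\epsilon(x)=f(x)-\big([AA^\top]^{-1}A\nabla f(x)\big)^\top(Ax-b)+\frac1\epsilon\|Ax-b\|^2 .$$ The $n\times n$ matrix $W(x)$ is $$W(x)=\sum_{i=1}^n \nabla_{x_i}\nabla^2 f(x)\,A^\top[AA^\top]^{-1}(Ax-b)\,(e_i^n)^\top,$$ where $\nabla_{x_i}\nabla^2 f(x)$ is the entrywise partial derivative of the Hessian with respect to $x_i$, and $e_i^n$ is the $i$-th standard unit vector of $\mathbb{R}^n$. Nesterov's iteration applied to $f^\epsilon$, where $\alpha>0$ is the stepsize: $$x_{k+1}=y_k-\alpha\nabla f^\epsilon(y_k),\quad a_{k+1}=\frac{1+\sqrt{4a_k^2+1}}{2},\quad y_{k+1}=x_{k+1}+\frac{a_k-1}{a_{k+1}}(x_{k+1}-x_k).$$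
   Formalization: The convergence guarantee is stated only for stepsizes with αL ≤ 1 and when x* and all y_k lie in D or f^ε is convex on all of R^n (it fails otherwise in general); C may also depend on α and the problem data; the minimum defining ε̄ is taken as an infimum. *)

theory Defs
  imports "HOL-Analysis.Analysis"
begin

subsection \<open>Partial derivatives, gradient, Hessian\<close>

definition partial_deriv :: "'n \<Rightarrow> (real ^ 'n \<Rightarrow> real) \<Rightarrow> real ^ 'n \<Rightarrow> real" where
  "partial_deriv i h x = deriv (\<lambda>t. h (x + t *\<^sub>R axis i 1)) 0"

definition gradient :: "(real ^ 'n \<Rightarrow> real) \<Rightarrow> real ^ 'n \<Rightarrow> real ^ 'n" where
  "gradient f x = (\<chi> i. partial_deriv i f x)"

definition hessian :: "(real ^ 'n \<Rightarrow> real) \<Rightarrow> real ^ 'n \<Rightarrow> real ^ 'n ^ 'n" where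
  "hessian f x = (\<chi> j k. partial_deriv k (partial_deriv j f) x)"

definition partial_hessian :: "'n \<Rightarrow> (real ^ 'n \<Rightarrow> real) \<Rightarrow> real ^ 'n \<Rightarrow> real ^ 'n ^ 'n" where
  "partial_hessian i f x = (\<chi> j k. partial_deriv i (\<lambda>z. hessian f z $ j $ k) x)"

subsection \<open>Eigenvalues and definiteness\<close>

text \<open>
  Only real eigenvalues are considered; every matrix to which these notions are applied below
  is symmetric, so these are all its eigenvalues.
\<close>

definition eigenvalues :: "real ^ 'm ^ 'm \<Rightarrow> real set" where
  "eigenvalues M = {l. \<exists>v. v \<noteq> 0 \<and> M *v v = l *\<^sub>R v}"

definition lambda_min :: "real ^ 'm ^ 'm \<Rightarrow> real" where
  "lambda_min M = Min (eigenvalues M)"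

definition lambda_max :: "real ^ 'm ^ 'm \<Rightarrow> real" where
  "lambda_max M = Max (eigenvalues M)"

definition positive_definite :: "real ^ 'm ^ 'm \<Rightarrow> bool" where
  "positive_definite M \<longleftrightarrow> (\<forall>z. z \<noteq> 0 \<longrightarrow> 0 < z \<bullet> (M *v z))"

subsection \<open>Penalty function\<close>

definition penalty ::
  "(real ^ 'n \<Rightarrow> real) \<Rightarrow> real ^ 'n ^ 'p \<Rightarrow> real ^ 'p \<Rightarrow> real \<Rightarrow> real ^ 'n \<Rightarrow> real" where
  "penalty f A b \<epsilon> x =
     f x - (matrix_inv (A ** transpose A) *v (A *v gradient f x)) \<bullet> (A *v x - b)
         + (1 / \<epsilon>) * (norm (A *v x - b))\<^sup>2"

definition W_matrix ::
  "(real ^ 'n \<Rightarrow> real) \<Rightarrow> real ^ 'n ^ 'p \<Rightarrow> real ^ 'p \<Rightarrow> real ^ 'n \<Rightarrow> real ^ 'n ^ 'n" where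
  "W_matrix f A b x =
     (\<Sum>i\<in>UNIV.
        (columnvector (partial_hessian i f x *v
           (transpose A *v (matrix_inv (A ** transpose A) *v (A *v x - b)))) :: real ^ 1 ^ 'n)
        ** rowvector (axis i 1))"

definition R_fun ::
  "(real ^ 'n \<Rightarrow> real) \<Rightarrow> real ^ 'n ^ 'p \<Rightarrow> real ^ 'p \<Rightarrow> real ^ 'n \<Rightarrow> real" where
  "R_fun f A b x =
     2 * lambda_max (hessian f x) - lambda_min (hessian f x - W_matrix f A b x)"

definition eps_ratio ::
  "(real ^ 'n \<Rightarrow> real) \<Rightarrow> real ^ 'n ^ 'p \<Rightarrow> real ^ 'p \<Rightarrow> real ^ 'n \<Rightarrow> real" where
  "eps_ratio f A b x =
     2 * lambda_min (A ** transpose A) * lambda_min (hessian f x - W_matrix f A b x)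
     / ((lambda_max (hessian f x))\<^sup>2
        + R_fun f A b x * lambda_min (hessian f x - W_matrix f A b x))"

text \<open>
  The third derivatives of \<open>f\<close> need not be continuous, so the minimum defining the threshold need
  not be attained. It is therefore taken as an extended-real infimum, which equals the minimum
  whenever that exists and does not produce an unspecified value when the ratio is unbounded
  below.
\<close>

definition eps_bar ::
  "(real ^ 'n \<Rightarrow> real) \<Rightarrow> real ^ 'n ^ 'p \<Rightarrow> real ^ 'p \<Rightarrow> (real ^ 'n) set \<Rightarrow> ereal" where
  "eps_bar f A b D = (INF x\<in>D. ereal (eps_ratio f A b x))"

subsection \<open>Nesterov's iteration\<close>

definition nesterov_iteration ::
  "(real ^ 'n \<Rightarrow> real) \<Rightarrow> real \<Rightarrow> real ^ 'n \<Rightarrow>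
    (nat \<Rightarrow> real ^ 'n) \<Rightarrow> (nat \<Rightarrow> real ^ 'n) \<Rightarrow> (nat \<Rightarrow> real) \<Rightarrow> bool" where
  "nesterov_iteration g \<alpha> x0 x y a \<longleftrightarrow>
     x 0 = x0 \<and> y 0 = x0 \<and> a 0 = 1 \<and>
     (\<forall>k. x (Suc k) = y k - \<alpha> *\<^sub>R gradient g (y k)) \<and>
     (\<forall>k. a (Suc k) = (1 + sqrt (4 * (a k)\<^sup>2 + 1)) / 2) \<and>
     (\<forall>k. y (Suc k) = x (Suc k) + ((a k - 1) / a (Suc k)) *\<^sub>R (x (Suc k) - x k))"

end

theory Submission
  imports Defs
begin

text \<open>
  Write \<open>H\<close> for the Hessian of \<open>f\<close>, \<open>K = H - W\<close>, and \<open>P = A\<^sup>T (A A\<^sup>T)\<^sup>-\<^sup>1 A\<close> for the orthogonal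
  projection onto the row space of \<open>A\<close>.

  Convexity. Differentiating the penalty function twice gives the quadratic form
  \<open>d \<bullet> K d - 2 (P d \<bullet> H d) + (2/\<epsilon>) |A d|\<^sup>2\<close>. Its nonnegativity is a computation with three numbers
  \<open>m = \<lambda>_min K > 0\<close>, \<open>l = \<lambda>_max H\<close> and \<open>s = \<lambda>_min (A A\<^sup>T) > 0\<close>: splitting \<open>d = u + w\<close> with \<open>w = P d\<close> and
  \<open>A u = 0\<close>, the form is at least \<open>m |u|\<^sup>2 - 2 l |u| |w| + (m - 2 l + 2 s / \<epsilon>) |w|\<^sup>2\<close>, and the threshold
  on \<open>\<epsilon>\<close>, when positive, says exactly that the last coefficient is at least \<open>l\<^sup>2 / m\<close>, so that the bound is at
  least \<open>m (|u| - (l / m) |w|)\<^sup>2\<close>. This is \<open>penalty_form_nonneg\<close>. The bounds by extreme eigenvalues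
  need \<open>H\<close> and \<open>W\<close> to be symmetric; both symmetries are instances of the symmetry of the
  second derivative (\<open>second_derivative_symmetric\<close>), applied to \<open>f\<close> and to the directional derivative
  of \<open>f\<close> along a fixed vector.

  Convergence rate. The accelerated method decreases the energy
  \<open>2 \<alpha> a\<^sub>k (a\<^sub>k - 1) (g (x\<^sub>k) - g (x\<^sup>*)) + |a\<^sub>k y\<^sub>k - (a\<^sub>k - 1) x\<^sub>k - x\<^sup>*|\<^sup>2\<close> (\<open>energy_decrease\<close>), and
  \<open>a\<^sub>k \<ge> (k + 2) / 2\<close>. Convexity enters through tangent inequalities between \<open>y\<^sub>k\<close> and the
  two points \<open>x\<^sub>k\<close>, \<open>x\<^sup>*\<close> only, so it is enough that \<open>g\<close> is convex on a convex set that contains the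
  minimizer and all \<open>y\<^sub>k\<close>: each \<open>x\<^sub>k\<close> then lies in it too (\<open>x_in_domain\<close>). The constant may be
  chosen before the minimizer because the iteration is determined by its starting point and all
  minimizers share one value.
\<close>

section \<open>Tangents, second derivatives and convexity\<close>

lemma line_derivative:
  fixes F :: "'a::real_normed_vector \<Rightarrow> real"
  assumes "(F has_derivative F') (at (x + t *\<^sub>R d))"
  shows "((\<lambda>s. F (x + s *\<^sub>R d)) has_real_derivative F' d) (at t)"
proof -
  have lin: "linear F'"
    using assms has_derivative_linear by blast
  have "((\<lambda>s. x + s *\<^sub>R d) has_derivative (\<lambda>s. s *\<^sub>R d)) (at t)"
    by (auto intro!: derivative_eq_intros)
  from has_derivative_compose[OF this assms]
  have "((\<lambda>s. F (x + s *\<^sub>R d)) has_derivative (\<lambda>s. F' (s *\<^sub>R d))) (at t)" .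
  moreover have "(\<lambda>s. F' (s *\<^sub>R d)) = (*) (F' d)"
    using linear_scale[OF lin] by (auto simp: mult.commute)
  ultimately show ?thesis
    by (simp add: has_field_derivative_def)
qed

text \<open>
  The point of tangency may lie on the boundary of \<open>D\<close>: only difference quotients along the segment
  from \<open>y\<close> to \<open>z\<close> are used.
\<close>

lemma above_tangent:
  fixes g :: "'a::real_normed_vector \<Rightarrow> real"
  assumes cvx: "convex_on D g" and y: "y \<in> D" and z: "z \<in> D"
    and der: "(g has_derivative g') (at y)"
  shows "g y + g' (z - y) \<le> g z"
proof -
  have "((\<lambda>s. g (y + s *\<^sub>R (z - y))) has_real_derivative g' (z - y)) (at 0)"
    by (rule line_derivative) (use der in simp)
  then have "((\<lambda>s. (g (y + s *\<^sub>R (z - y)) - g y) / s) \<longlongrightarrow> g' (z - y)) (at 0)"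
    by (simp add: DERIV_def)
  then have lim: "((\<lambda>s. (g (y + s *\<^sub>R (z - y)) - g y) / s) \<longlongrightarrow> g' (z - y)) (at_right 0)"
    by (simp add: filterlim_at_split)
  have "(g (y + s *\<^sub>R (z - y)) - g y) / s \<le> g z - g y" if "0 < s" "s < 1" for s
  proof -
    have "g ((1 - s) *\<^sub>R y + s *\<^sub>R z) \<le> (1 - s) * g y + s * g z"
      by (rule convex_onD[OF cvx]) (use that y z in auto)
    moreover have "(1 - s) *\<^sub>R y + s *\<^sub>R z = y + s *\<^sub>R (z - y)"
      by (simp add: algebra_simps)
    ultimately show ?thesis
      using that by (simp add: field_simps)
  qed
  then have "eventually (\<lambda>s. (g (y + s *\<^sub>R (z - y)) - g y) / s \<le> g z - g y) (at_right 0)"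
    by (intro eventually_at_rightI[of 0 1]) auto
  from tendsto_upperbound[OF lim this] show ?thesis
    by simp
qed

lemma convex_on_second_derivative:
  fixes g :: "'a::real_inner \<Rightarrow> real"
  assumes D: "convex D"
    and g: "\<And>x. x \<in> D \<Longrightarrow> (g has_derivative (\<lambda>d. G x \<bullet> d)) (at x)"
    and G: "\<And>x. x \<in> D \<Longrightarrow> (G has_derivative M x) (at x)"
    and psd: "\<And>x d. x \<in> D \<Longrightarrow> 0 \<le> M x d \<bullet> d"
  shows "convex_on D g"
proof (rule convex_onI)
  fix t x y assume t: "0 < (t::real)" "t < 1" and xy: "x \<in> D" "y \<in> D"
  define d where "d = y - x"
  have mem: "x + s *\<^sub>R d \<in> D" if "s \<in> {0..1}" for s
  proof -
    have "(1 - s) *\<^sub>R x + s *\<^sub>R y \<in> D"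
      using D xy that by (simp add: convex_alt)
    then show ?thesis
      by (simp add: d_def algebra_simps)
  qed
  have cvx: "convex_on {0..1} (\<lambda>s. g (x + s *\<^sub>R d))"
  proof (rule f''_ge0_imp_convex)
    fix s :: real assume s: "s \<in> {0..1}"
    show "((\<lambda>s. g (x + s *\<^sub>R d)) has_real_derivative G (x + s *\<^sub>R d) \<bullet> d) (at s)"
      by (rule line_derivative[where F' = "\<lambda>e. G (x + s *\<^sub>R d) \<bullet> e"]) (rule g[OF mem[OF s]])
    show "((\<lambda>s. G (x + s *\<^sub>R d) \<bullet> d) has_real_derivative M (x + s *\<^sub>R d) d \<bullet> d) (at s)"
      by (rule line_derivative[where F = "\<lambda>z. G z \<bullet> d"])
         (intro has_derivative_inner_left G mem s)
    show "0 \<le> M (x + s *\<^sub>R d) d \<bullet> d"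
      by (intro psd mem s)
  qed simp
  have "g (x + ((1 - t) *\<^sub>R 0 + t *\<^sub>R 1) *\<^sub>R d) \<le> (1 - t) * g (x + 0 *\<^sub>R d) + t * g (x + 1 *\<^sub>R d)"
    by (rule convex_onD[OF cvx]) (use t in auto)
  then show "g ((1 - t) *\<^sub>R x + t *\<^sub>R y) \<le> (1 - t) * g x + t * g y"
    by (simp add: d_def algebra_simps)
qed (rule D)

lemma convex_imp_second_derivative_nonneg:
  fixes g :: "'a::real_inner \<Rightarrow> real"
  assumes cvx: "convex_on UNIV g"
    and g: "\<And>x. (g has_derivative (\<lambda>d. G x \<bullet> d)) (at x)"
    and G: "(G has_derivative M) (at x)"
  shows "0 \<le> M d \<bullet> d"
proof -
  have mono: "0 \<le> (G z - G x) \<bullet> (z - x)" for z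
    using above_tangent[OF cvx _ _ g, of x z] above_tangent[OF cvx _ _ g, of z x]
    by (simp add: inner_diff)
  have "((\<lambda>s. G (x + s *\<^sub>R d) \<bullet> d) has_real_derivative M d \<bullet> d) (at 0)"
    by (rule line_derivative[where F = "\<lambda>z. G z \<bullet> d"])
       (use G in \<open>auto intro!: has_derivative_inner_left\<close>)
  then have "((\<lambda>s. (G (x + s *\<^sub>R d) \<bullet> d - G x \<bullet> d) / s) \<longlongrightarrow> M d \<bullet> d) (at 0)"
    by (simp add: DERIV_def)
  then have lim: "((\<lambda>s. (G (x + s *\<^sub>R d) \<bullet> d - G x \<bullet> d) / s) \<longlongrightarrow> M d \<bullet> d) (at_right 0)"
    by (simp add: filterlim_at_split)
  have "0 \<le> (G (x + s *\<^sub>R d) \<bullet> d - G x \<bullet> d) / s" if "0 < s" for s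
    using mono[of "x + s *\<^sub>R d"] that by (simp add: inner_diff zero_le_mult_iff)
  then have "eventually (\<lambda>s. 0 \<le> (G (x + s *\<^sub>R d) \<bullet> d - G x \<bullet> d) / s) (at_right 0)"
    by (intro eventually_at_rightI[of 0 1]) auto
  from tendsto_lowerbound[OF lim this] show ?thesis
    by simp
qed

text \<open>
  The second difference of \<open>F\<close> over a small parallelogram is symmetric in its two sides and
  approximates \<open>t\<^sup>2\<close> times the second derivative. The mean value theorem is applied along \<open>u\<close> to the
  difference of \<open>F\<close> between the two sides parallel to \<open>u\<close>; differentiability of \<open>G\<close> at the single point
  \<open>x\<close> controls the resulting increment of the gradient.
\<close>

lemma second_difference_bound:
  fixes F :: "'a::real_inner \<Rightarrow> real"
  assumes F: "\<And>y. (F has_derivative (\<lambda>d. G y \<bullet> d)) (at y)"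
    and lin: "linear h"
    and G: "\<And>y. norm (y - x) < \<delta> \<Longrightarrow> norm (G y - G x - h (y - x)) \<le> e * norm (y - x)"
    and t: "0 < t" "t * (norm u + norm v) < \<delta>" and e: "0 \<le> e"
  shows "\<bar>F (x + t *\<^sub>R u + t *\<^sub>R v) - F (x + t *\<^sub>R u) - F (x + t *\<^sub>R v) + F x - t\<^sup>2 * (h v \<bullet> u)\<bar>
    \<le> 2 * e * t\<^sup>2 * (norm u + norm v) * norm u"
proof -
  define K where "K = norm u + norm v"
  have "\<exists>s\<in>{0<..<t}. (F (x + t *\<^sub>R v + t *\<^sub>R u) - F (x + t *\<^sub>R u)) - (F (x + t *\<^sub>R v + 0 *\<^sub>R u) - F (x + 0 *\<^sub>R u))
      = (t - 0) * (G (x + t *\<^sub>R v + s *\<^sub>R u) \<bullet> u - G (x + s *\<^sub>R u) \<bullet> u)"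
  proof -
    have "((\<lambda>s. F (x + t *\<^sub>R v + s *\<^sub>R u) - F (x + s *\<^sub>R u)) has_real_derivative
      (G (x + t *\<^sub>R v + s *\<^sub>R u) \<bullet> u - G (x + s *\<^sub>R u) \<bullet> u)) (at s)" for s
      by (intro DERIV_diff line_derivative[where F' = "\<lambda>d. G _ \<bullet> d"] F)
    then show ?thesis
      using MVT2[OF t(1), of "\<lambda>s. F (x + t *\<^sub>R v + s *\<^sub>R u) - F (x + s *\<^sub>R u)"] by fastforce
  qed
  then obtain s where s: "0 < s" "s < t" and S: "F (x + t *\<^sub>R u + t *\<^sub>R v) - F (x + t *\<^sub>R u) - F (x + t *\<^sub>R v) + F x
      = t * ((G (x + t *\<^sub>R v + s *\<^sub>R u) - G (x + s *\<^sub>R u)) \<bullet> u)"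
    by (auto simp: algebra_simps inner_diff)
  have n1: "norm (t *\<^sub>R v + s *\<^sub>R u) \<le> t * K"
  proof -
    have "norm (t *\<^sub>R v + s *\<^sub>R u) \<le> t * norm v + s * norm u"
      by (rule order_trans[OF norm_triangle_ineq]) (use s in simp)
    also have "\<dots> \<le> t * norm v + t * norm u"
      using s by (intro add_left_mono mult_right_mono) auto
    finally show ?thesis
      by (simp add: K_def algebra_simps)
  qed
  have n2: "norm (s *\<^sub>R u) \<le> t * K"
    using s by (auto simp: K_def intro!: mult_mono)
  define r where "r y = G y - G x - h (y - x)" for y
  have r: "norm (r (x + w)) \<le> e * (t * K)" if "norm w \<le> t * K" for w
  proof -
    have "norm (r (x + w)) \<le> e * norm w"
      using G[of "x + w"] that t(2) by (simp add: r_def K_def)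
    also have "\<dots> \<le> e * (t * K)"
      using that e by (rule mult_left_mono)
    finally show ?thesis .
  qed
  have "G (x + t *\<^sub>R v + s *\<^sub>R u) - G (x + s *\<^sub>R u)
      = t *\<^sub>R h v + (r (x + (t *\<^sub>R v + s *\<^sub>R u)) - r (x + s *\<^sub>R u))"
    by (simp add: r_def linear_add[OF lin] linear_scale[OF lin] add.assoc)
  then have "(G (x + t *\<^sub>R v + s *\<^sub>R u) - G (x + s *\<^sub>R u)) \<bullet> u
      = t * (h v \<bullet> u) + (r (x + (t *\<^sub>R v + s *\<^sub>R u)) - r (x + s *\<^sub>R u)) \<bullet> u"
    by (simp add: inner_add_left)
  then have "F (x + t *\<^sub>R u + t *\<^sub>R v) - F (x + t *\<^sub>R u) - F (x + t *\<^sub>R v) + F x - t\<^sup>2 * (h v \<bullet> u)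
      = t * ((r (x + (t *\<^sub>R v + s *\<^sub>R u)) - r (x + s *\<^sub>R u)) \<bullet> u)"
    unfolding S by (simp add: distrib_left power2_eq_square)
  also have "\<bar>\<dots>\<bar> \<le> t * (norm (r (x + (t *\<^sub>R v + s *\<^sub>R u)) - r (x + s *\<^sub>R u)) * norm u)"
    using t(1) by (simp add: abs_mult Cauchy_Schwarz_ineq2)
  also have "\<dots> \<le> t * ((e * (t * K) + e * (t * K)) * norm u)"
    using t(1) by (intro mult_left_mono mult_right_mono order_trans[OF norm_triangle_ineq4] add_mono r n1 n2) auto
  also have "\<dots> = 2 * e * t\<^sup>2 * K * norm u"
    by (simp add: power2_eq_square algebra_simps)
  finally show ?thesis
    by (simp add: K_def)
qed

text \<open>
  The second difference is within \<open>o(t\<^sup>2)\<close> of both \<open>t\<^sup>2 (h v \<bullet> u)\<close> and \<open>t\<^sup>2 (h u \<bullet> v)\<close>.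
\<close>

lemma second_derivative_symmetric:
  fixes F :: "'a::real_inner \<Rightarrow> real"
  assumes F: "\<And>y. (F has_derivative (\<lambda>d. G y \<bullet> d)) (at y)"
    and G: "(G has_derivative h) (at x)"
  shows "h u \<bullet> v = h v \<bullet> u"
proof -
  define K where "K = norm u + norm v"
  have K: "K \<ge> 0" by (simp add: K_def)
  have lin: "linear h"
    using G has_derivative_linear by blast
  have bound: "\<bar>h v \<bullet> u - h u \<bullet> v\<bar> \<le> e * (2 * K\<^sup>2)" if e: "0 < e" for e
  proof -
    obtain \<delta> where \<delta>: "\<delta> > 0" "\<And>y. norm (y - x) < \<delta> \<Longrightarrow> norm (G y - G x - h (y - x)) \<le> e * norm (y - x)"
      using G e unfolding has_derivative_at_alt by blast
    \<comment> \<open>Adding one to \<open>K\<close> keeps the denominator positive when \<open>u\<close> and \<open>v\<close> vanish.\<close>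
    define t where "t = \<delta> / (K + 1) / 2"
    have t: "t > 0" using \<delta>(1) K by (simp add: t_def)
    have "t * K < \<delta>"
      using \<delta>(1) K by (simp add: t_def field_simps add_strict_increasing2)
    define S where "S = F (x + t *\<^sub>R u + t *\<^sub>R v) - F (x + t *\<^sub>R u) - F (x + t *\<^sub>R v) + F x"
    have "\<bar>S - t\<^sup>2 * (h v \<bullet> u)\<bar> \<le> 2 * e * t\<^sup>2 * K * norm u"
      using second_difference_bound[OF F lin \<delta>(2) t, where u = u and v = v] \<open>t * K < \<delta>\<close> e
      by (simp add: K_def S_def)
    moreover have "\<bar>S - t\<^sup>2 * (h u \<bullet> v)\<bar> \<le> 2 * e * t\<^sup>2 * K * norm v"
      using second_difference_bound[OF F lin \<delta>(2) t, where u = v and v = u] \<open>t * K < \<delta>\<close> e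
      by (simp add: K_def S_def algebra_simps)
    ultimately have "\<bar>t\<^sup>2 * (h v \<bullet> u) - t\<^sup>2 * (h u \<bullet> v)\<bar> \<le> 2 * e * t\<^sup>2 * K * norm u + 2 * e * t\<^sup>2 * K * norm v"
      by linarith
    also have "\<dots> = t\<^sup>2 * (e * (2 * K\<^sup>2))"
      by (simp add: K_def power2_eq_square algebra_simps)
    finally have "t\<^sup>2 * \<bar>h v \<bullet> u - h u \<bullet> v\<bar> \<le> t\<^sup>2 * (e * (2 * K\<^sup>2))"
      by (simp add: abs_mult flip: right_diff_distrib)
    then show ?thesis
      using t by simp
  qed
  have "\<bar>h v \<bullet> u - h u \<bullet> v\<bar> \<le> 0"
  proof (rule field_le_epsilon)
    fix e :: real assume e: "0 < e"
    have "\<bar>h v \<bullet> u - h u \<bullet> v\<bar> \<le> e / (2 * K\<^sup>2 + 1) * (2 * K\<^sup>2)"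
      by (rule bound) (use e in \<open>simp add: add_nonneg_pos\<close>)
    also have "\<dots> \<le> e"
      using e by (simp add: divide_le_eq add_nonneg_pos mult_left_mono)
    finally show "\<bar>h v \<bullet> u - h u \<bullet> v\<bar> \<le> 0 + e"
      by simp
  qed
  then show ?thesis by simp
qed

lemma descent_lemma:
  fixes g :: "'a::real_inner \<Rightarrow> real"
  assumes g: "\<And>x. (g has_derivative (\<lambda>d. G x \<bullet> d)) (at x)"
    and lip: "L-lipschitz_on UNIV G"
  shows "g (y + d) \<le> g y + G y \<bullet> d + L / 2 * (d \<bullet> d)"
proof -
  define \<psi> where "\<psi> s = g (y + s *\<^sub>R d) - s * (G y \<bullet> d) - s\<^sup>2 * (L / 2 * (d \<bullet> d))" for s
  have "\<psi> 1 \<le> \<psi> 0"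
  proof (rule DERIV_nonpos_imp_nonincreasing[where f = \<psi>])
    fix s :: real assume s: "0 \<le> s" "s \<le> 1"
    have "(\<psi> has_real_derivative G (y + s *\<^sub>R d) \<bullet> d - G y \<bullet> d - 2 * s * (L / 2 * (d \<bullet> d))) (at s)"
      unfolding \<psi>_def
      by (intro DERIV_diff line_derivative[where F' = "\<lambda>d. G _ \<bullet> d"] g)
         (auto intro!: derivative_eq_intros)
    moreover have "(G (y + s *\<^sub>R d) - G y) \<bullet> d \<le> L * s * (d \<bullet> d)"
    proof -
      have "(G (y + s *\<^sub>R d) - G y) \<bullet> d \<le> norm (G (y + s *\<^sub>R d) - G y) * norm d"
        by (rule norm_cauchy_schwarz)
      also have "\<dots> \<le> (L * norm (s *\<^sub>R d)) * norm d"
        using lipschitz_onD[OF lip, of "y + s *\<^sub>R d" y]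
        by (intro mult_right_mono) (auto simp: dist_norm)
      also have "\<dots> = L * s * (d \<bullet> d)"
        using s by (simp add: dot_square_norm power2_eq_square mult_ac)
      finally show ?thesis .
    qed
    ultimately show "\<exists>y. (\<psi> has_real_derivative y) (at s) \<and> y \<le> 0"
      by (intro exI conjI) (auto simp: inner_diff mult_ac)
  qed simp
  then show ?thesis
    by (simp add: \<psi>_def)
qed

section \<open>Extreme eigenvalues of symmetric matrices\<close>

text \<open>
  The quadratic \<open>t \<mapsto> (u + t w) \<bullet> T (u + t w)\<close> is nonnegative; it is evaluated at its vertex, or, if it
  degenerates to an affine function, at a point where a nonzero slope would make it negative.
\<close>

lemma psd_Cauchy_Schwarz:
  fixes T :: "'a::real_inner \<Rightarrow> 'a"
  assumes lin: "linear T" and sym: "\<And>u v. T u \<bullet> v = u \<bullet> T v" and psd: "\<And>u. 0 \<le> u \<bullet> T u"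
  shows "(u \<bullet> T w)\<^sup>2 \<le> (u \<bullet> T u) * (w \<bullet> T w)"
proof -
  define a b c where "a = u \<bullet> T u" and "b = u \<bullet> T w" and "c = w \<bullet> T w"
  have wu: "w \<bullet> T u = b"
    using sym[of w u] by (simp add: b_def inner_commute)
  have q: "0 \<le> a + 2 * t * b + t\<^sup>2 * c" for t
    using psd[of "u + t *\<^sub>R w"] wu
    by (simp add: linear_add[OF lin] linear_scale[OF lin] inner_add a_def b_def c_def
        power2_eq_square algebra_simps)
  have a0: "0 \<le> a" and c0: "0 \<le> c"
    using psd by (simp_all add: a_def c_def)
  have "b\<^sup>2 \<le> a * c"
  proof (cases "c = 0")
    case True
    have "b = 0"
    proof (rule ccontr)
      assume "b \<noteq> 0"
      then show False
        using q[of "- (a + 1) / (2 * b)"] True a0 by (simp add: field_simps)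
    qed
    then show ?thesis using True by simp
  next
    case False
    then show ?thesis
      using q[of "- b / c"] c0 by (simp add: field_simps power2_eq_square)
  qed
  then show ?thesis
    by (simp add: a_def b_def c_def)
qed

text \<open>
  Eigenvectors of a symmetric matrix for different eigenvalues are orthogonal, hence independent.
  Finiteness is what makes the \<open>Min\<close> and \<open>Max\<close> in the definitions of the extreme eigenvalues meaningful.
\<close>

lemma finite_eigenvalues:
  fixes M :: "real ^ 'n ^ 'n"
  assumes sym: "\<And>u v. (M *v u) \<bullet> v = u \<bullet> (M *v v)"
  shows "finite (eigenvalues M)"
proof -
  have "\<forall>l\<in>eigenvalues M. \<exists>v. v \<noteq> 0 \<and> M *v v = l *\<^sub>R v"
    by (simp add: eigenvalues_def)
  then obtain e where e: "\<And>l. l \<in> eigenvalues M \<Longrightarrow> e l \<noteq> 0 \<and> M *v e l = l *\<^sub>R e l"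
    by metis
  have orth: "e k \<bullet> e l = 0" if "k \<in> eigenvalues M" "l \<in> eigenvalues M" "k \<noteq> l" for k l
    using sym[of "e k" "e l"] e[OF that(1)] e[OF that(2)] that(3) by simp
  have "inj_on e (eigenvalues M)"
    by (rule inj_onI) (metis e orth inner_eq_zero_iff)
  moreover have "independent (e ` eigenvalues M)"
    by (rule pairwise_orthogonal_independent)
       (auto simp: pairwise_def orthogonal_def dest: e intro: orth)
  then have "finite (e ` eigenvalues M)"
    by (rule finiteI_independent)
  ultimately show ?thesis
    using finite_imageD by blast
qed

text \<open>
  A minimizer \<open>v\<close> of the Rayleigh quotient on the unit sphere is an eigenvector: \<open>M - l I\<close> is positive
  semidefinite and its form vanishes at \<open>v\<close>, so by \<open>psd_Cauchy_Schwarz\<close> it annihilates \<open>v\<close>.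
\<close>

lemma least_eigenvalue:
  fixes M :: "real ^ 'n ^ 'n"
  assumes sym: "\<And>u v. (M *v u) \<bullet> v = u \<bullet> (M *v v)"
  shows "\<exists>l\<in>eigenvalues M. \<forall>z. l * (z \<bullet> z) \<le> z \<bullet> (M *v z)"
proof -
  have "compact (sphere (0::real^'n) 1)" "sphere (0::real^'n) 1 \<noteq> {}"
    by auto
  moreover have "continuous_on (sphere 0 1) (\<lambda>z. z \<bullet> (M *v z))"
    by (intro continuous_intros matrix_vector_mult_linear_continuous_on)
  ultimately obtain v where v: "norm v = 1" and vmin: "\<And>z. norm z = 1 \<Longrightarrow> v \<bullet> (M *v v) \<le> z \<bullet> (M *v z)"
    using continuous_attains_inf[of "sphere (0::real^'n) 1" "\<lambda>z. z \<bullet> (M *v z)"] by auto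
  define l where "l = v \<bullet> (M *v v)"
  have lower: "l * (z \<bullet> z) \<le> z \<bullet> (M *v z)" for z
  proof (cases "z = 0")
    case False
    then have "l \<le> (z /\<^sub>R norm z) \<bullet> (M *v (z /\<^sub>R norm z))"
      unfolding l_def by (intro vmin) simp
    also have "\<dots> = (z \<bullet> (M *v z)) / (norm z)\<^sup>2"
      by (simp add: matrix_vector_mult_scaleR power2_eq_square field_simps)
    finally show ?thesis
      using False by (simp add: field_simps dot_square_norm)
  qed simp
  define T where "T z = M *v z - l *\<^sub>R z" for z
  have "linear T"
    unfolding T_def
    by (intro linear_compose_sub matrix_vector_mul_linear linear_scaleR)
  moreover have "T u \<bullet> w = u \<bullet> T w" for u w
    using sym by (simp add: T_def inner_diff)
  moreover have "0 \<le> u \<bullet> T u" for u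
    using lower by (simp add: T_def inner_diff)
  ultimately have "(T v \<bullet> T v)\<^sup>2 \<le> (T v \<bullet> T (T v)) * (v \<bullet> T v)"
    by (rule psd_Cauchy_Schwarz)
  also have "v \<bullet> T v = 0"
    using v by (simp add: T_def inner_diff l_def dot_square_norm)
  finally have "M *v v = l *\<^sub>R v"
    by (simp add: T_def)
  then have "l \<in> eigenvalues M"
    using v by (auto simp: eigenvalues_def intro!: exI[of _ v])
  then show ?thesis
    using lower by blast
qed

lemma lambda_min_properties:
  fixes M :: "real ^ 'n ^ 'n"
  assumes sym: "\<And>u v. (M *v u) \<bullet> v = u \<bullet> (M *v v)"
  shows lambda_min_eigenvalue: "lambda_min M \<in> eigenvalues M"
    and lambda_min_le: "lambda_min M * (z \<bullet> z) \<le> z \<bullet> (M *v z)"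
proof -
  obtain l where l: "l \<in> eigenvalues M" "\<And>z. l * (z \<bullet> z) \<le> z \<bullet> (M *v z)"
    using least_eigenvalue[OF sym] by blast
  have fin: "finite (eigenvalues M)"
    using finite_eigenvalues[OF sym] .
  then show "lambda_min M \<in> eigenvalues M"
    using l(1) unfolding lambda_min_def by (metis Min_in empty_iff)
  have "lambda_min M \<le> l"
    unfolding lambda_min_def using fin l(1) by simp
  then have "lambda_min M * (z \<bullet> z) \<le> l * (z \<bullet> z)"
    by (intro mult_right_mono) auto
  then show "lambda_min M * (z \<bullet> z) \<le> z \<bullet> (M *v z)"
    using l(2)[of z] by linarith
qed

lemma lambda_min_pos:
  fixes M :: "real ^ 'n ^ 'n"
  assumes sym: "\<And>u v. (M *v u) \<bullet> v = u \<bullet> (M *v v)" and pd: "positive_definite M"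
  shows "0 < lambda_min M"
proof -
  obtain v where v: "v \<noteq> 0" "M *v v = lambda_min M *\<^sub>R v"
    using lambda_min_eigenvalue[OF sym] by (auto simp: eigenvalues_def)
  then have "0 < lambda_min M * (v \<bullet> v)"
    using pd by (metis positive_definite_def inner_scaleR_right)
  then show ?thesis
    using v(1) by (metis inner_gt_zero_iff zero_less_mult_pos2)
qed

lemma uminus_matrix_vector_mult: "(- M) *v u = - (M *v u)" for M :: "real ^ 'n ^ 'm"
  by (simp add: matrix_vector_mult_def vec_eq_iff sum_negf)

lemma eigenvalues_uminus: "eigenvalues (- M) = uminus ` eigenvalues M"
proof -
  have "- (M *v v) = l *\<^sub>R v \<longleftrightarrow> M *v v = (- l) *\<^sub>R v" for l v
    using neg_equal_iff_equal[of "- (M *v v)" "l *\<^sub>R v"] by simp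
  then have "l \<in> eigenvalues (- M) \<longleftrightarrow> - l \<in> eigenvalues M" for l
    by (simp add: eigenvalues_def uminus_matrix_vector_mult)
  then show ?thesis
    by (force intro: image_eqI[of _ uminus "- _"])
qed

lemma lambda_max_ge:
  fixes M :: "real ^ 'n ^ 'n"
  assumes sym: "\<And>u v. (M *v u) \<bullet> v = u \<bullet> (M *v v)"
  shows "z \<bullet> (M *v z) \<le> lambda_max M * (z \<bullet> z)"
proof -
  have sym': "((- M) *v u) \<bullet> v = u \<bullet> ((- M) *v v)" for u v
    using sym by (simp add: uminus_matrix_vector_mult)
  have "eigenvalues M \<noteq> {}" "finite (eigenvalues M)"
    using least_eigenvalue[OF sym] finite_eigenvalues[OF sym] by auto
  then have "lambda_min (- M) = - lambda_max M"
    by (simp add: lambda_min_def lambda_max_def eigenvalues_uminus minus_Max_eq_Min)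
  then show ?thesis
    using lambda_min_le[OF sym', of z] by (simp add: uminus_matrix_vector_mult)
qed

lemma matrix_inv_right:
  fixes M :: "real ^ 'n ^ 'n"
  assumes "inj ((*v) M)"
  shows "M *v (matrix_inv M *v q) = q"
proof -
  obtain B where "B ** M = mat 1" "M ** B = mat 1"
    using assms matrix_left_invertible_injective matrix_left_right_inverse by metis
  then have "\<exists>B. M ** B = mat 1 \<and> B ** M = mat 1" by blast
  then have "M ** matrix_inv M = mat 1 \<and> matrix_inv M ** M = mat 1"
    unfolding matrix_inv_def by (rule someI_ex)
  then show ?thesis
    by (simp add: matrix_vector_mul_assoc)
qed

lemma inner_transpose:
  fixes A :: "real ^ 'n ^ 'p"
  shows "(A *v x) \<bullet> q = x \<bullet> (transpose A *v q)"
  by (metis dot_lmul_matrix inner_commute transpose_matrix_vector)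

lemma gram_symmetric:
  "((A ** transpose A) *v p) \<bullet> q = p \<bullet> ((A ** transpose A) *v q)" for A :: "real ^ 'n ^ 'p"
  by (metis inner_commute inner_transpose matrix_vector_mul_assoc)

context
  fixes A :: "real ^ 'n ^ 'p"
  assumes rank: "rank A = CARD('p)"
begin

lemma gram_positive_definite: "positive_definite (A ** transpose A)"
  unfolding positive_definite_def
proof (intro allI impI)
  fix z :: "real ^ 'p" assume z: "z \<noteq> 0"
  have "inj ((*v) (transpose A))"
    using rank full_rank_injective[of "transpose A"] by (simp add: rank_transpose)
  then have "transpose A *v z \<noteq> 0"
    using z by (metis injD matrix_vector_mult_0_right)
  then have "0 < (transpose A *v z) \<bullet> (transpose A *v z)"
    by simp
  also have "\<dots> = z \<bullet> ((A ** transpose A) *v z)"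
    by (metis inner_commute inner_transpose matrix_vector_mul_assoc)
  finally show "0 < z \<bullet> ((A ** transpose A) *v z)" .
qed

lemma gram_inj: "inj ((*v) (A ** transpose A))"
proof (rule injI)
  fix p q assume "(A ** transpose A) *v p = (A ** transpose A) *v q"
  then have "(A ** transpose A) *v (p - q) = 0"
    by (simp add: matrix_vector_mult_diff_distrib)
  then show "p = q"
    using gram_positive_definite unfolding positive_definite_def
    by (metis inner_zero_right less_irrefl right_minus_eq)
qed

lemmas gram_inv = matrix_inv_right[OF gram_inj]

lemma gram_inv_symmetric:
  "(matrix_inv (A ** transpose A) *v p) \<bullet> q = p \<bullet> (matrix_inv (A ** transpose A) *v q)"
  by (metis gram_inv gram_symmetric)

end

section \<open>Derivatives of the penalty function\<close>

lemma partial_deriv_eq: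
  assumes "(h has_derivative h') (at x)"
  shows "partial_deriv i h x = h' (axis i 1)"
  unfolding partial_deriv_def
  by (rule DERIV_imp_deriv, rule line_derivative) (use assms in simp)

lemma has_derivative_gradient:
  assumes "h differentiable (at x)"
  shows "(h has_derivative (\<lambda>d. gradient h x \<bullet> d)) (at x)"
proof -
  obtain h' where h': "(h has_derivative h') (at x)"
    using assms differentiable_def by blast
  have "h' d = gradient h x \<bullet> d" for d
  proof -
    have "h' d = h' (\<Sum>i\<in>UNIV. d $ i *\<^sub>R axis i 1)"
      by (metis basis_expansion scalar_mult_eq_scaleR)
    also have "\<dots> = (\<Sum>i\<in>UNIV. d $ i * h' (axis i 1))"
      using has_derivative_linear[OF h'] by (simp add: linear_sum linear_scale)
    also have "\<dots> = gradient h x \<bullet> d"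
      by (simp add: inner_vec_def gradient_def partial_deriv_eq[OF h'] mult.commute)
    finally show ?thesis .
  qed
  then show ?thesis
    using h' by presburger
qed

lemma has_derivative_hessian:
  assumes "gradient h differentiable (at x)"
  shows "(gradient h has_derivative (\<lambda>d. hessian h x *v d)) (at x)"
proof -
  obtain T where T: "(gradient h has_derivative T) (at x)"
    using assms differentiable_def by blast
  have "partial_deriv k (partial_deriv j h) x = T (axis k 1) $ j" for j k
  proof -
    have "((\<lambda>z. gradient h z $ j) has_derivative (\<lambda>d. T d $ j)) (at x)"
      by (rule bounded_linear.has_derivative[OF bounded_linear_vec_nth T])
    then show ?thesis
      using partial_deriv_eq by (fastforce simp: gradient_def)
  qed
  then have "hessian h x = matrix T"
    by (simp add: hessian_def matrix_def)
  then have "T d = hessian h x *v d" for d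
    using has_derivative_linear[OF T] by (simp add: matrix_works)
  then show ?thesis
    using T by presburger
qed

lemma partial_hessian_eq:
  assumes "(hessian h has_derivative T) (at x)"
  shows "partial_hessian i h x = T (axis i 1)"
proof -
  have "((\<lambda>z. hessian h z $ j $ k) has_derivative (\<lambda>d. T d $ j $ k)) (at x)" for j k
    by (intro bounded_linear.has_derivative[OF bounded_linear_vec_nth] assms)
  then have "partial_deriv i (\<lambda>z. hessian h z $ j $ k) x = T (axis i 1) $ j $ k" for j k
    using partial_deriv_eq by blast
  then show ?thesis
    by (simp add: partial_hessian_def vec_eq_iff)
qed

lemma bounded_bilinear_matrix_vector_mult:
  "bounded_bilinear (\<lambda>(M :: real ^ 'n ^ 'm) v. M *v v)"
proof -
  have "linear (\<lambda>M :: real ^ 'n ^ 'm. M *v v)" for v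
    by (rule linearI)
       (simp_all add: matrix_vector_mult_add_rdistrib scaleR_matrix_vector_assoc)
  then show ?thesis
    unfolding bilinear_conv_bounded_bilinear[symmetric] bilinear_def by auto
qed

lemma outer_product_mult:
  "(columnvector u ** (rowvector (axis i 1) :: real ^ 'n ^ 1)) *v d = d $ i *\<^sub>R (u :: real ^ 'n)"
  by (simp add: columnvector_def rowvector_def matrix_matrix_mult_def matrix_vector_mult_def
      vec_eq_iff axis_def if_distrib if_distribR mult.commute cong: if_cong)

lemma sum_matrix_vector_mult:
  "(\<Sum>i\<in>I. M i) *v d = (\<Sum>i\<in>I. M i *v (d :: real ^ 'n))" for M :: "'i \<Rightarrow> real ^ 'n ^ 'm"
  using bounded_bilinear.sum_left[OF bounded_bilinear_matrix_vector_mult] .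

text \<open>
  For \<open>A\<close> of full row rank this is the Moore-Penrose pseudoinverse: a right inverse of \<open>A\<close> whose
  composition with \<open>A\<close> is the orthogonal projection onto the row space.
\<close>

definition pseudo_inverse :: "real ^ 'n ^ 'p \<Rightarrow> real ^ 'p \<Rightarrow> real ^ 'n" where
  "pseudo_inverse A q = transpose A *v (matrix_inv (A ** transpose A) *v q)"

text \<open>
  The columns of \<open>W\<close> are the partial derivatives of the Hessian applied to one fixed vector, so \<open>W\<close> maps a
  direction to the directional derivative of the Hessian applied to that vector.
\<close>

lemma W_matrix_mult:
  assumes "(hessian f has_derivative T) (at x)"
  shows "W_matrix f A b x *v d = T d *v pseudo_inverse A (A *v x - b)"
proof -
  have "W_matrix f A b x *v d = (\<Sum>i\<in>UNIV. d $ i *\<^sub>R (T (axis i 1) *v pseudo_inverse A (A *v x - b)))"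
    by (simp add: W_matrix_def sum_matrix_vector_mult outer_product_mult partial_hessian_eq[OF assms]
        pseudo_inverse_def)
  also have "\<dots> = (\<Sum>i\<in>UNIV. d $ i *\<^sub>R T (axis i 1)) *v pseudo_inverse A (A *v x - b)"
    by (simp add: sum_matrix_vector_mult scaleR_matrix_vector_assoc)
  also have "(\<Sum>i\<in>UNIV. d $ i *\<^sub>R T (axis i 1)) = T (\<Sum>i\<in>UNIV. d $ i *\<^sub>R axis i 1)"
    using has_derivative_linear[OF assms] by (simp add: linear_sum linear_scale)
  also have "(\<Sum>i\<in>UNIV. d $ i *\<^sub>R axis i 1) = d"
    by (metis basis_expansion scalar_mult_eq_scaleR)
  finally show ?thesis .
qed

lemma pseudo_inverse_inner:
  assumes "rank A = CARD('p)"
  shows "(matrix_inv (A ** transpose A) *v (A *v d)) \<bullet> q = d \<bullet> pseudo_inverse A (q :: real ^ 'p)"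
  unfolding pseudo_inverse_def gram_inv_symmetric[OF assms] by (rule inner_transpose)

lemma pseudo_inverse_symmetric:
  assumes "rank A = CARD('p)"
  shows "pseudo_inverse A (A *v d) \<bullet> e = d \<bullet> pseudo_inverse (A :: real ^ 'n ^ 'p) (A *v e)"
  by (metis pseudo_inverse_inner[OF assms] pseudo_inverse_def inner_commute inner_transpose)

lemma bounded_linear_pseudo_inverse: "bounded_linear (pseudo_inverse A)"
  unfolding pseudo_inverse_def
  by (intro bounded_linear_compose[OF matrix_vector_mul_bounded_linear] matrix_vector_mul_bounded_linear)

lemma penalty_eq:
  fixes A :: "real ^ 'n ^ 'p"
  assumes "rank A = CARD('p)"
  shows "penalty f A b \<epsilon> x = f x - gradient f x \<bullet> pseudo_inverse A (A *v x - b)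
    + 1 / \<epsilon> * ((A *v x - b) \<bullet> (A *v x - b))"
  by (simp add: penalty_def pseudo_inverse_inner[OF assms] power2_norm_eq_inner)

definition penalty_gradient :: "(real ^ 'n \<Rightarrow> real) \<Rightarrow> real ^ 'n ^ 'p \<Rightarrow> real ^ 'p \<Rightarrow> real \<Rightarrow> real ^ 'n \<Rightarrow> real ^ 'n" where
  "penalty_gradient f A b \<epsilon> x = gradient f x - hessian f x *v pseudo_inverse A (A *v x - b)
     - pseudo_inverse A (A *v gradient f x) + (2 / \<epsilon>) *\<^sub>R (transpose A *v (A *v x - b))"

lemma penalty_has_derivative:
  fixes A :: "real ^ 'n ^ 'p"
  assumes rank: "rank A = CARD('p)"
    and f: "f differentiable (at x)" and f2: "gradient f differentiable (at x)"
    and sym: "\<And>u v. (hessian f x *v u) \<bullet> v = u \<bullet> (hessian f x *v v)"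
  shows "(penalty f A b \<epsilon> has_derivative (\<lambda>d. penalty_gradient f A b \<epsilon> x \<bullet> d)) (at x)"
proof -
  note bl = bounded_linear.has_derivative[OF bounded_linear_pseudo_inverse]
    bounded_linear.has_derivative[OF matrix_vector_mul_bounded_linear]
  have r: "((\<lambda>z. A *v z - b) has_derivative (\<lambda>d. A *v d)) (at x)"
    by (auto intro!: derivative_eq_intros bl)
  have "((\<lambda>z. f z - gradient f z \<bullet> pseudo_inverse A (A *v z - b) + 1 / \<epsilon> * ((A *v z - b) \<bullet> (A *v z - b)))
    has_derivative (\<lambda>d. gradient f x \<bullet> d
      - (gradient f x \<bullet> pseudo_inverse A (A *v d) + (hessian f x *v d) \<bullet> pseudo_inverse A (A *v x - b))
      + 1 / \<epsilon> * ((A *v x - b) \<bullet> (A *v d) + (A *v d) \<bullet> (A *v x - b)))) (at x)"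
    by (intro has_derivative_add has_derivative_diff has_derivative_mult_right has_derivative_inner
        has_derivative_gradient[OF f] has_derivative_hessian[OF f2] bl(1) r)
  moreover have "(\<lambda>d. gradient f x \<bullet> d
      - (gradient f x \<bullet> pseudo_inverse A (A *v d) + (hessian f x *v d) \<bullet> pseudo_inverse A (A *v x - b))
      + 1 / \<epsilon> * ((A *v x - b) \<bullet> (A *v d) + (A *v d) \<bullet> (A *v x - b)))
      = (\<lambda>d. penalty_gradient f A b \<epsilon> x \<bullet> d)"
  proof
    fix d
    have "gradient f x \<bullet> pseudo_inverse A (A *v d) = pseudo_inverse A (A *v gradient f x) \<bullet> d"
      by (simp add: pseudo_inverse_symmetric[OF rank])
    moreover have "(hessian f x *v d) \<bullet> pseudo_inverse A (A *v x - b) = (hessian f x *v pseudo_inverse A (A *v x - b)) \<bullet> d"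
      by (metis sym inner_commute)
    moreover have "(A *v x - b) \<bullet> (A *v d) = (transpose A *v (A *v x - b)) \<bullet> d"
      by (metis inner_transpose inner_commute)
    ultimately show "gradient f x \<bullet> d
      - (gradient f x \<bullet> pseudo_inverse A (A *v d) + (hessian f x *v d) \<bullet> pseudo_inverse A (A *v x - b))
      + 1 / \<epsilon> * ((A *v x - b) \<bullet> (A *v d) + (A *v d) \<bullet> (A *v x - b))
      = penalty_gradient f A b \<epsilon> x \<bullet> d"
      by (simp add: penalty_gradient_def inner_diff inner_add inner_commute[of "A *v d"]
          del: transpose_matrix_vector)
  qed
  ultimately show ?thesis
    unfolding penalty_eq[OF rank, abs_def] by simp
qed

lemma penalty_gradient_has_derivative:
  fixes A :: "real ^ 'n ^ 'p"
  assumes f2: "gradient f differentiable (at x)" and T: "(hessian f has_derivative T) (at x)"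
  shows "(penalty_gradient f A b \<epsilon> has_derivative
    (\<lambda>d. (hessian f x - W_matrix f A b x) *v d - hessian f x *v pseudo_inverse A (A *v d)
      - pseudo_inverse A (A *v (hessian f x *v d)) + (2 / \<epsilon>) *\<^sub>R (transpose A *v (A *v d)))) (at x)"
proof -
  note bl = bounded_linear.has_derivative[OF bounded_linear_pseudo_inverse]
    bounded_linear.has_derivative[OF matrix_vector_mul_bounded_linear]
  have r: "((\<lambda>z. A *v z - b) has_derivative (\<lambda>d. A *v d)) (at x)"
    by (auto intro!: derivative_eq_intros bl)
  have "(penalty_gradient f A b \<epsilon> has_derivative
    (\<lambda>d. hessian f x *v d - (hessian f x *v pseudo_inverse A (A *v d) + T d *v pseudo_inverse A (A *v x - b))
      - pseudo_inverse A (A *v (hessian f x *v d)) + (2 / \<epsilon>) *\<^sub>R (transpose A *v (A *v d)))) (at x)"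
    unfolding penalty_gradient_def[abs_def]
    by (intro has_derivative_add has_derivative_diff has_derivative_scaleR_right
        bounded_bilinear.FDERIV[OF bounded_bilinear_matrix_vector_mult]
        has_derivative_hessian[OF f2] T bl r)
  then show ?thesis
    by (simp add: matrix_vector_mult_diff_rdistrib W_matrix_mult[OF T] diff_diff_eq add.commute
        del: transpose_matrix_vector)
qed

lemma mult_pseudo_inverse:
  fixes A :: "real ^ 'n ^ 'p"
  assumes rank: "rank A = CARD('p)"
  shows "A *v pseudo_inverse A q = q"
  unfolding pseudo_inverse_def using gram_inv[OF rank] by (metis matrix_vector_mul_assoc)

text \<open>
  With \<open>q = N p\<close> for \<open>N = A A\<^sup>T\<close>, the squared norm of the pseudoinverse of \<open>q\<close> is \<open>p \<bullet> q\<close>. The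
  eigenvalue bound \<open>s |p|\<^sup>2 \<le> p \<bullet> q\<close> and the Cauchy-Schwarz inequality give \<open>s |p| \<le> |q|\<close>, and a second use of
  Cauchy-Schwarz gives the claim. Applied to \<open>q = A d\<close> it bounds the penalty term from below
  on the row space.
\<close>

lemma norm_pseudo_inverse_le:
  fixes A :: "real ^ 'n ^ 'p"
  assumes rank: "rank A = CARD('p)"
  shows "lambda_min (A ** transpose A) * (norm (pseudo_inverse A q))\<^sup>2 \<le> (norm q)\<^sup>2"
proof -
  define p where "p = matrix_inv (A ** transpose A) *v q"
  define s where "s = lambda_min (A ** transpose A)"
  have q: "(A ** transpose A) *v p = q"
    by (simp add: p_def gram_inv[OF rank])
  have s: "0 \<le> s"
    unfolding s_def
    using lambda_min_pos[OF gram_symmetric gram_positive_definite[OF rank]] by simp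
  have sq: "(norm (pseudo_inverse A q))\<^sup>2 = p \<bullet> q"
    unfolding power2_norm_eq_inner q[symmetric] pseudo_inverse_def p_def[symmetric]
    by (metis inner_commute inner_transpose matrix_vector_mul_assoc q p_def)
  have "s * (norm p)\<^sup>2 \<le> p \<bullet> q"
    using lambda_min_le[OF gram_symmetric[of A], where z = p] q by (simp add: s_def power2_norm_eq_inner)
  also have pq: "p \<bullet> q \<le> norm p * norm q"
    by (rule norm_cauchy_schwarz)
  finally have "norm p * (s * norm p) \<le> norm p * norm q"
    by (simp add: power2_eq_square mult_ac)
  then have sp: "s * norm p \<le> norm q"
    by (cases "p = 0") auto
  have "s * (p \<bullet> q) \<le> s * (norm p * norm q)"
    using pq s by (rule mult_left_mono)
  also have "\<dots> \<le> norm q * norm q"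
    using sp mult_right_mono[of "s * norm p" "norm q" "norm q"] by (simp add: mult.assoc)
  finally show ?thesis
    unfolding sq s_def power2_eq_square[of "norm q"] .
qed

text \<open>
  This is where the threshold for \<open>\<epsilon>\<close> comes from; \<open>H\<close> stands for the Hessian and \<open>K\<close> for \<open>H - W\<close>.
  The denominator of the threshold may be negative or zero, but then the threshold is not positive and
  the two conditions on \<open>\<epsilon>\<close> exclude each other.
\<close>

lemma penalty_form_nonneg:
  fixes A :: "real ^ 'n ^ 'p" and H K :: "real ^ 'n ^ 'n"
  assumes rank: "rank A = CARD('p)"
    and H: "\<And>u v. (H *v u) \<bullet> v = u \<bullet> (H *v v)" "\<And>u. 0 \<le> u \<bullet> (H *v u)"
    and K: "\<And>u v. (K *v u) \<bullet> v = u \<bullet> (K *v v)" "positive_definite K"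
    and \<epsilon>: "0 < \<epsilon>"
      "\<epsilon> \<le> 2 * lambda_min (A ** transpose A) * lambda_min K
        / ((lambda_max H)\<^sup>2 + (2 * lambda_max H - lambda_min K) * lambda_min K)"
  shows "0 \<le> d \<bullet> (K *v d) - 2 * (pseudo_inverse A (A *v d) \<bullet> (H *v d)) + 2 / \<epsilon> * (norm (A *v d))\<^sup>2"
proof -
  define m l s where "m = lambda_min K" and "l = lambda_max H" and "s = lambda_min (A ** transpose A)"
  define w u where "w = pseudo_inverse A (A *v d)" and "u = d - w"
  have m: "0 < m"
    unfolding m_def by (rule lambda_min_pos[OF K])
  have s: "0 < s"
    unfolding s_def by (rule lambda_min_pos[OF gram_symmetric gram_positive_definite[OF rank]])
  define Q where "Q = l\<^sup>2 + (2 * l - m) * m"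
  have \<epsilon>Q: "\<epsilon> \<le> 2 * s * m / Q"
    using \<epsilon>(2) by (simp add: m_def l_def s_def Q_def)
  have Q: "0 < Q"
    using \<epsilon>(1) \<epsilon>Q s m by (smt (verit) divide_nonneg_nonpos mult_pos_pos)
  \<comment> \<open>This is the threshold condition, solved for the coefficient of \<open>|w|\<^sup>2\<close>.\<close>
  have coeff: "l\<^sup>2 / m \<le> 2 / \<epsilon> * s + m - 2 * l"
  proof -
    have "\<epsilon> * Q \<le> 2 * s * m"
      using \<epsilon>Q Q by (simp add: pos_le_divide_eq)
    then have "Q / m \<le> 2 / \<epsilon> * s"
      using \<epsilon>(1) m by (simp add: field_simps)
    moreover have "Q / m = l\<^sup>2 / m + 2 * l - m"
      using m by (simp add: Q_def field_simps power2_eq_square)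
    ultimately show ?thesis by simp
  qed
  have Au: "A *v u = 0"
    by (simp add: u_def w_def matrix_vector_mult_diff_distrib mult_pseudo_inverse[OF rank])
  have uw: "u \<bullet> w = 0"
    unfolding w_def using pseudo_inverse_symmetric[OF rank, of u d] Au
    by (simp add: linear_0[OF bounded_linear.linear[OF bounded_linear_pseudo_inverse]])
  have d: "d = u + w"
    by (simp add: u_def)
  have nd: "d \<bullet> d = (norm u)\<^sup>2 + (norm w)\<^sup>2"
    using uw by (simp add: d inner_add inner_commute power2_norm_eq_inner)
  have Hw: "w \<bullet> (H *v w) \<le> l * (norm w)\<^sup>2" for w
    using lambda_max_ge[OF H(1), of w] by (simp add: l_def power2_norm_eq_inner)
  have l: "0 \<le> l"
    using order_trans[OF H(2)[of "axis undefined 1"] Hw[of "axis undefined 1"]] by (simp add: norm_axis_1)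
  have Huw: "w \<bullet> (H *v u) \<le> l * norm u * norm w"
  proof (rule power2_le_imp_le)
    have "(w \<bullet> (H *v u))\<^sup>2 \<le> (w \<bullet> (H *v w)) * (u \<bullet> (H *v u))"
      by (rule psd_Cauchy_Schwarz[OF matrix_vector_mul_linear H])
    also have "\<dots> \<le> (l * (norm w)\<^sup>2) * (l * (norm u)\<^sup>2)"
      using l by (intro mult_mono Hw H(2)) auto
    finally show "(w \<bullet> (H *v u))\<^sup>2 \<le> (l * norm u * norm w)\<^sup>2"
      by (simp add: power2_eq_square mult_ac)
  qed (use l in simp)
  have "w \<bullet> (H *v d) \<le> l * norm u * norm w + l * (norm w)\<^sup>2"
    using Huw Hw[of w] by (simp add: d matrix_vector_right_distrib inner_add)
  moreover have "m * ((norm u)\<^sup>2 + (norm w)\<^sup>2) \<le> d \<bullet> (K *v d)"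
    using lambda_min_le[OF K(1), of d] nd by (simp add: m_def)
  moreover have "2 / \<epsilon> * (s * (norm w)\<^sup>2) \<le> 2 / \<epsilon> * (norm (A *v d))\<^sup>2"
    unfolding s_def w_def using \<epsilon>(1) by (intro mult_left_mono norm_pseudo_inverse_le[OF rank]) auto
  moreover have "l\<^sup>2 / m * (norm w)\<^sup>2 \<le> (2 / \<epsilon> * s + m - 2 * l) * (norm w)\<^sup>2"
    using coeff by (intro mult_right_mono) auto
  moreover have "0 \<le> m * (norm u - l / m * norm w)\<^sup>2"
    using m by simp
  moreover have "m * (norm u - l / m * norm w)\<^sup>2 = m * (norm u)\<^sup>2 - 2 * (l * norm u * norm w) + l\<^sup>2 / m * (norm w)\<^sup>2"
    using m by (simp add: field_simps power2_eq_square)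
  ultimately show ?thesis
    unfolding w_def[symmetric] by (simp add: algebra_simps)
qed

section \<open>Accelerated gradient descent on a convex set\<close>

text \<open>
  The descent lemma at a step size of at most \<open>1 / L\<close> gains \<open>\<alpha> / 2\<close> times the squared gradient; the
  tangent inequality compares the value at \<open>y\<close> with the one at \<open>z\<close>. The new point itself may leave \<open>D\<close>.
\<close>

lemma nesterov_step:
  fixes g :: "'a::real_inner \<Rightarrow> real"
  assumes g: "\<And>x. (g has_derivative (\<lambda>d. G x \<bullet> d)) (at x)"
    and lip: "L-lipschitz_on UNIV G" and \<alpha>: "0 < \<alpha>" "\<alpha> * L \<le> 1"
    and cvx: "convex_on D g" and D: "y \<in> D" "z \<in> D"
  shows "g (y - \<alpha> *\<^sub>R G y) - g z \<le> G y \<bullet> (y - z) - \<alpha> / 2 * (G y \<bullet> G y)"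
proof -
  have "g (y - \<alpha> *\<^sub>R G y) \<le> g y - \<alpha> * (G y \<bullet> G y) + L / 2 * (\<alpha> * (\<alpha> * (G y \<bullet> G y)))"
    using descent_lemma[OF g lip, of y "- (\<alpha> *\<^sub>R G y)"] by simp
  also have "L / 2 * (\<alpha> * (\<alpha> * (G y \<bullet> G y))) = (\<alpha> * L) * (\<alpha> / 2 * (G y \<bullet> G y))"
    by simp
  also have "\<dots> \<le> \<alpha> / 2 * (G y \<bullet> G y)"
    using \<alpha> by (intro mult_left_le_one_le) (auto simp: lipschitz_on_nonneg[OF lip])
  finally have "g (y - \<alpha> *\<^sub>R G y) \<le> g y - \<alpha> / 2 * (G y \<bullet> G y)"
    by (simp add: field_simps)
  moreover have "g y + G y \<bullet> (z - y) \<le> g z"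
    using above_tangent[OF cvx D g] .
  ultimately show ?thesis
    by (simp add: inner_diff)
qed

locale nesterov =
  fixes g :: "'a::real_inner \<Rightarrow> real" and G :: "'a \<Rightarrow> 'a" and \<alpha> :: real
    and x y :: "nat \<Rightarrow> 'a" and a :: "nat \<Rightarrow> real"
  assumes init: "y 0 = x 0" "a 0 = 1"
    and x_Suc: "\<And>k. x (Suc k) = y k - \<alpha> *\<^sub>R G (y k)"
    and a_Suc: "\<And>k. a (Suc k) = (1 + sqrt (4 * (a k)\<^sup>2 + 1)) / 2"
    and y_Suc: "\<And>k. y (Suc k) = x (Suc k) + ((a k - 1) / a (Suc k)) *\<^sub>R (x (Suc k) - x k)"
begin

lemma a_lower: "(real k + 2) / 2 \<le> a k"
proof (induction k)
  case (Suc k)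
  have "2 * a k \<le> sqrt (4 * (a k)\<^sup>2 + 1)"
    by (rule real_le_rsqrt) (simp add: power_mult_distrib)
  then show ?case
    using Suc unfolding a_Suc by simp
qed (simp add: init)

lemma a_ge_1: "1 \<le> a k"
  using a_lower[of k] by simp

lemma a_quadratic: "a (Suc k) * (a (Suc k) - 1) = (a k)\<^sup>2"
  unfolding a_Suc by (simp add: field_simps power2_eq_square)

text \<open>
  Since the extrapolation coefficient \<open>c\<close> is nonnegative, \<open>x\<^sub>k\<^sub>+\<^sub>1\<close> is a convex combination of
  \<open>y\<^sub>k\<^sub>+\<^sub>1\<close> and \<open>x\<^sub>k\<close>.
\<close>

lemma x_in_domain:
  assumes D: "convex D" and y: "\<And>k. y k \<in> D"
  shows "x k \<in> D"
proof (induction k)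
  case 0
  show ?case using y[of 0] init by simp
next
  case (Suc k)
  define c where "c = (a k - 1) / a (Suc k)"
  have c: "0 \<le> c"
    unfolding c_def using a_ge_1[of k] a_ge_1[of "Suc k"] by simp
  have "(1 + c) *\<^sub>R x (Suc k) = y (Suc k) + c *\<^sub>R x k"
    unfolding y_Suc c_def[symmetric] by (simp add: algebra_simps)
  then have "x (Suc k) = (1 / (1 + c)) *\<^sub>R (y (Suc k) + c *\<^sub>R x k)"
    using c by (metis add_nonneg_eq_0_iff divide_inverse mult_1 scaleR_left_imp_eq scaleR_scaleR
        right_inverse scaleR_one zero_le_one zero_neq_one)
  then have "x (Suc k) = (1 / (1 + c)) *\<^sub>R y (Suc k) + (c / (1 + c)) *\<^sub>R x k"
    by (simp add: scaleR_add_right)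
  also have "\<dots> \<in> D"
    by (rule convexD[OF D y Suc]) (use c in \<open>auto simp: field_simps\<close>)
  finally show ?case .
qed

text \<open>
  The step inequality is taken \<open>a\<^sub>k - 1\<close> times with \<open>z = x\<^sub>k\<close> and once with \<open>z = x\<^sup>*\<close>. After multiplication by
  \<open>2 \<alpha> a\<^sub>k\<close> the right-hand side completes to a difference of two squares, and the extrapolation rule for
  \<open>y\<^sub>k\<^sub>+\<^sub>1\<close> is the one that makes the second square the next term of the sequence \<open>q\<close>.
  By \<open>a_quadratic\<close>, the coefficient \<open>a\<^sub>k\<^sup>2\<close> on the left is the energy coefficient of the next step.
\<close>

lemma energy_decrease:
  assumes \<alpha>: "0 < \<alpha>"
    and step: "\<And>k z. z \<in> D \<Longrightarrow> g (x (Suc k)) - g z \<le> G (y k) \<bullet> (y k - z) - \<alpha> / 2 * (G (y k) \<bullet> G (y k))"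
    and x: "x k \<in> D" and xs: "xs \<in> D"
  defines "q \<equiv> \<lambda>j. a j *\<^sub>R y j - (a j - 1) *\<^sub>R x j - xs"
  shows "2 * \<alpha> * (a k)\<^sup>2 * (g (x (Suc k)) - g xs) + (norm (q (Suc k)))\<^sup>2
    \<le> 2 * \<alpha> * (a k * (a k - 1)) * (g (x k) - g xs) + (norm (q k))\<^sup>2"
proof -
  define p where "p = G (y k)"
  have ak: "1 \<le> a k" by (rule a_ge_1)
  have "(a k - 1) * (g (x (Suc k)) - g (x k)) \<le> (a k - 1) * (p \<bullet> (y k - x k) - \<alpha> / 2 * (p \<bullet> p))"
    unfolding p_def using ak by (intro mult_left_mono step x) auto
  moreover have "g (x (Suc k)) - g xs \<le> p \<bullet> (y k - xs) - \<alpha> / 2 * (p \<bullet> p)"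
    unfolding p_def by (intro step xs)
  ultimately have "a k * (g (x (Suc k)) - g xs) - (a k - 1) * (g (x k) - g xs) \<le> p \<bullet> q k - a k * \<alpha> / 2 * (p \<bullet> p)"
    unfolding q_def by (simp add: inner_diff_right) argo
  then have "2 * \<alpha> * a k * (a k * (g (x (Suc k)) - g xs) - (a k - 1) * (g (x k) - g xs))
      \<le> 2 * \<alpha> * a k * (p \<bullet> q k - a k * \<alpha> / 2 * (p \<bullet> p))"
    using \<alpha> ak by (intro mult_left_mono) auto
  also have "\<dots> = (norm (q k))\<^sup>2 - (norm (q k - (\<alpha> * a k) *\<^sub>R p))\<^sup>2"
    unfolding power2_norm_eq_inner
    by (simp add: inner_diff inner_commute[of "q k" p] algebra_simps)
  also have "q k - (\<alpha> * a k) *\<^sub>R p = q (Suc k)"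
  proof -
    have "a (Suc k) *\<^sub>R y (Suc k) = a (Suc k) *\<^sub>R x (Suc k) + (a k - 1) *\<^sub>R (x (Suc k) - x k)"
      unfolding y_Suc using a_ge_1[of "Suc k"] by (simp add: scaleR_add_right)
    then have "q (Suc k) = a k *\<^sub>R x (Suc k) - (a k - 1) *\<^sub>R x k - xs"
      by (simp add: q_def algebra_simps)
    also have "\<dots> = q k - (\<alpha> * a k) *\<^sub>R p"
      by (simp add: x_Suc q_def p_def algebra_simps)
    finally show ?thesis by simp
  qed
  finally show ?thesis
    by (simp add: algebra_simps power2_eq_square)
qed

lemma rate:
  assumes g: "\<And>x. (g has_derivative (\<lambda>d. G x \<bullet> d)) (at x)"
    and lip: "L-lipschitz_on UNIV G" and \<alpha>: "0 < \<alpha>" "\<alpha> * L \<le> 1"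
    and cvx: "convex_on D g"
    and y: "\<And>k. y k \<in> D" and xs: "xs \<in> D"
  shows "g (x (Suc k)) - g xs \<le> (2 / \<alpha>) * (norm (x 0 - xs))\<^sup>2 / (real k + 2)\<^sup>2"
proof -
  define q where "q k = a k *\<^sub>R y k - (a k - 1) *\<^sub>R x k - xs" for k
  define E where "E k = 2 * \<alpha> * (a k * (a k - 1)) * (g (x k) - g xs) + (norm (q k))\<^sup>2" for k
  have D: "convex D"
    using cvx by (rule convex_on_imp_convex)
  have step: "g (x (Suc k)) - g z \<le> G (y k) \<bullet> (y k - z) - \<alpha> / 2 * (G (y k) \<bullet> G (y k))" if "z \<in> D" for k z
    unfolding x_Suc by (rule nesterov_step[OF g lip \<alpha> cvx y that])
  have decrease: "2 * \<alpha> * (a k)\<^sup>2 * (g (x (Suc k)) - g xs) + (norm (q (Suc k)))\<^sup>2 \<le> E k" for k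
    unfolding E_def q_def
    by (rule energy_decrease[OF \<alpha>(1) step x_in_domain[OF D y] xs])
  have "E k \<le> (norm (x 0 - xs))\<^sup>2"
  proof (induction k)
    case 0
    show ?case by (simp add: E_def q_def init)
  next
    case (Suc k)
    have "E (Suc k) \<le> E k"
      using decrease[of k] by (simp add: E_def a_quadratic)
    with Suc show ?case by simp
  qed
  then have "2 * \<alpha> * (a k)\<^sup>2 * (g (x (Suc k)) - g xs) \<le> (norm (x 0 - xs))\<^sup>2"
    using decrease[of k] by (smt (verit) zero_le_power2)
  then have "g (x (Suc k)) - g xs \<le> (norm (x 0 - xs))\<^sup>2 / (2 * \<alpha> * (a k)\<^sup>2)"
    using \<alpha> a_ge_1[of k] by (simp add: pos_le_divide_eq mult_ac)
  also have "\<dots> \<le> (norm (x 0 - xs))\<^sup>2 / (2 * \<alpha> * ((real k + 2) / 2)\<^sup>2)"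
    using \<alpha> a_lower[of k] by (intro divide_left_mono mult_left_mono power_mono mult_pos_pos) auto
  also have "\<dots> = (2 / \<alpha>) * (norm (x 0 - xs))\<^sup>2 / (real k + 2)\<^sup>2"
    by (simp add: power_divide)
  finally show ?thesis .
qed

end

section \<open>Convexity of the penalty function and the convergence rate\<close>

lemma nesterov_iteration_unique:
  assumes "nesterov_iteration g \<alpha> x0 x y a" and "nesterov_iteration g \<alpha> x0 x' y' a'"
  shows "x = x'" "y = y'"
proof -
  have "x k = x' k \<and> y k = y' k \<and> a k = a' k" for k
  proof (induction k)
    case 0
    show ?case using assms unfolding nesterov_iteration_def by simp
  next
    case (Suc k)
    then have "x (Suc k) = x' (Suc k)" "a (Suc k) = a' (Suc k)"
      using assms unfolding nesterov_iteration_def by metis+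
    then show ?case
      using assms Suc unfolding nesterov_iteration_def by metis
  qed
  then show "x = x'" "y = y'" by auto
qed

context
  fixes f :: "real ^ 'n \<Rightarrow> real"
  assumes f_convex: "convex_on UNIV f"
    and f: "\<And>x. f differentiable (at x)"
    and f2: "\<And>x. gradient f differentiable (at x)"
    and f3: "\<And>x. hessian f differentiable (at x)"
begin

lemma hessian_symmetric: "(hessian f x *v u) \<bullet> v = u \<bullet> (hessian f x *v v)"
  using second_derivative_symmetric[OF has_derivative_gradient[OF f] has_derivative_hessian[OF f2]]
  by (metis inner_commute)

lemma hessian_nonneg: "0 \<le> u \<bullet> (hessian f x *v u)"
  using convex_imp_second_derivative_nonneg[OF f_convex has_derivative_gradient[OF f] has_derivative_hessian[OF f2]]
  by (simp add: inner_commute)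

text \<open>
  For a fixed vector \<open>w\<close>, the function \<open>z \<mapsto> \<nabla>f(z) \<bullet> w\<close> has gradient \<open>H(z) w\<close>. The derivative of this
  gradient at \<open>x\<close> is the linear map \<open>W\<close> when \<open>w\<close> is the vector occurring in \<open>W(x)\<close>.
\<close>

lemma W_matrix_symmetric: "(W_matrix f A b x *v u) \<bullet> v = u \<bullet> (W_matrix f A b x *v v)"
proof -
  obtain T where T: "(hessian f has_derivative T) (at x)"
    using f3 differentiable_def by blast
  define w where "w = pseudo_inverse A (A *v x - b)"
  have "((\<lambda>z. gradient f z \<bullet> w) has_derivative (\<lambda>d. (hessian f z *v w) \<bullet> d)) (at z)" for z
  proof -
    have "((\<lambda>z. gradient f z \<bullet> w) has_derivative (\<lambda>d. (hessian f z *v d) \<bullet> w)) (at z)"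
      by (intro has_derivative_inner_left has_derivative_hessian f2)
    then show ?thesis
      using hessian_symmetric by (metis (no_types, lifting) ext inner_commute)
  qed
  moreover have "((\<lambda>z. hessian f z *v w) has_derivative (\<lambda>d. T d *v w)) (at x)"
    by (rule bounded_linear.has_derivative[OF
          bounded_bilinear.bounded_linear_left[OF bounded_bilinear_matrix_vector_mult] T])
  ultimately have "(T u *v w) \<bullet> v = (T v *v w) \<bullet> u"
    by (rule second_derivative_symmetric)
  then show ?thesis
    unfolding W_matrix_mult[OF T] w_def by (simp add: inner_commute)
qed

lemma penalty_convex:
  fixes A :: "real ^ 'n ^ 'p"
  assumes D: "convex D" and rank: "rank A = CARD('p)"
    and pos_def: "\<And>x. x \<in> D \<Longrightarrow> positive_definite (hessian f x - W_matrix f A b x)"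
    and \<epsilon>: "0 < \<epsilon>" "ereal \<epsilon> \<le> eps_bar f A b D"
  shows "convex_on D (penalty f A b \<epsilon>)"
proof (rule convex_on_second_derivative[OF D])
  fix x assume x: "x \<in> D"
  obtain T where T: "(hessian f has_derivative T) (at x)"
    using f3 differentiable_def by blast
  show "(penalty f A b \<epsilon> has_derivative (\<lambda>d. penalty_gradient f A b \<epsilon> x \<bullet> d)) (at x)"
    by (rule penalty_has_derivative[OF rank f f2 hessian_symmetric])
  show "(penalty_gradient f A b \<epsilon> has_derivative
    (\<lambda>d. (hessian f x - W_matrix f A b x) *v d - hessian f x *v pseudo_inverse A (A *v d)
      - pseudo_inverse A (A *v (hessian f x *v d)) + (2 / \<epsilon>) *\<^sub>R (transpose A *v (A *v d)))) (at x)"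
    by (rule penalty_gradient_has_derivative[OF f2 T])
  fix d
  define H K where "H = hessian f x" and "K = hessian f x - W_matrix f A b x"
  have "ereal \<epsilon> \<le> ereal (eps_ratio f A b x)"
    using \<epsilon>(2) x unfolding eps_bar_def by (meson INF_lower order_trans)
  then have \<epsilon>_le: "\<epsilon> \<le> 2 * lambda_min (A ** transpose A) * lambda_min K
        / ((lambda_max H)\<^sup>2 + (2 * lambda_max H - lambda_min K) * lambda_min K)"
    by (simp add: eps_ratio_def R_fun_def H_def K_def)
  have K: "(K *v u) \<bullet> v = u \<bullet> (K *v v)" for u v
    by (simp add: K_def matrix_vector_mult_diff_rdistrib inner_diff hessian_symmetric W_matrix_symmetric)
  have "(H *v pseudo_inverse A (A *v d)) \<bullet> d = pseudo_inverse A (A *v d) \<bullet> (H *v d)"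
    by (simp add: H_def hessian_symmetric)
  moreover have "pseudo_inverse A (A *v (H *v d)) \<bullet> d = pseudo_inverse A (A *v d) \<bullet> (H *v d)"
    by (metis pseudo_inverse_symmetric[OF rank] inner_commute)
  moreover have "(transpose A *v (A *v d)) \<bullet> d = (norm (A *v d))\<^sup>2"
    by (metis inner_commute inner_transpose power2_norm_eq_inner)
  ultimately have "(K *v d - H *v pseudo_inverse A (A *v d) - pseudo_inverse A (A *v (H *v d))
      + (2 / \<epsilon>) *\<^sub>R (transpose A *v (A *v d))) \<bullet> d
    = d \<bullet> (K *v d) - 2 * (pseudo_inverse A (A *v d) \<bullet> (H *v d)) + 2 / \<epsilon> * (norm (A *v d))\<^sup>2"
    by (simp add: inner_diff inner_add inner_commute[of "K *v d"] del: transpose_matrix_vector)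
  also have "0 \<le> \<dots>"
    using penalty_form_nonneg[OF rank _ _ K _ \<epsilon>(1) \<epsilon>_le] hessian_symmetric hessian_nonneg pos_def[OF x]
    by (simp add: H_def K_def)
  finally show "0 \<le> ((hessian f x - W_matrix f A b x) *v d - hessian f x *v pseudo_inverse A (A *v d)
      - pseudo_inverse A (A *v (hessian f x *v d)) + (2 / \<epsilon>) *\<^sub>R (transpose A *v (A *v d))) \<bullet> d"
    by (simp add: H_def K_def)
qed

end

text \<open>
  The second argument of the maximum covers \<open>k = 0\<close>, before any gradient step has been made.
\<close>

lemma nesterov_iteration_rate:
  fixes g :: "real ^ 'n \<Rightarrow> real"
  assumes g: "\<And>x. g differentiable (at x)"
    and lip: "L-lipschitz_on UNIV (gradient g)" and \<alpha>: "0 < \<alpha>" "\<alpha> * L \<le> 1"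
    and iter: "nesterov_iteration g \<alpha> x0 x y a"
    and cvx: "convex_on D g" and y: "\<And>k. y k \<in> D" and xs: "xs \<in> D"
  shows "g (x k) - g xs \<le> max (2 / \<alpha> * (norm (x0 - xs))\<^sup>2) (g x0 - g xs) / (real k + 1)\<^sup>2"
proof (cases k)
  case 0
  then show ?thesis
    using iter by (simp add: nesterov_iteration_def)
next
  case (Suc j)
  interpret nesterov g "gradient g" \<alpha> x y a
    using iter by unfold_locales (auto simp: nesterov_iteration_def)
  have "g (x k) - g xs \<le> 2 / \<alpha> * (norm (x 0 - xs))\<^sup>2 / (real j + 2)\<^sup>2"
    unfolding Suc by (rule rate[OF has_derivative_gradient[OF g] lip \<alpha> cvx y xs])
  also have "\<dots> \<le> max (2 / \<alpha> * (norm (x0 - xs))\<^sup>2) (g x0 - g xs) / (real j + 2)\<^sup>2"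
    using iter by (intro divide_right_mono) (auto simp: nesterov_iteration_def)
  finally show ?thesis
    by (simp add: Suc add.commute)
qed

theorem mainTheorem1:
  fixes f :: "real ^ 'n \<Rightarrow> real"
    and A :: "real ^ 'n ^ 'p"
    and b :: "real ^ 'p"
    and D :: "(real ^ 'n) set"
  assumes f_convex: "convex_on UNIV f"
    and f_diff: "f differentiable_on UNIV"
    and f_diff2: "gradient f differentiable_on UNIV"
    and f_C2: "continuous_on UNIV (hessian f)"
    and f_diff3: "hessian f differentiable_on UNIV"
    and D_convex: "convex D"
    and D_compact: "compact D"
    and D_regular: "D = closure (interior D)"
    and A_rank: "rank A = CARD('p)"
    and p_less_n: "CARD('p) < CARD('n)"
    and pos_def: "\<forall>x\<in>D. positive_definite (hessian f x - W_matrix f A b x)"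
  shows "\<forall>\<epsilon>. 0 < \<epsilon> \<and> ereal \<epsilon> \<le> eps_bar f A b D \<longrightarrow>
           convex_on D (penalty f A b \<epsilon>) \<and>
           (\<forall>L \<alpha> x0. L-lipschitz_on UNIV (gradient (penalty f A b \<epsilon>)) \<and> 0 < \<alpha> \<and> \<alpha> * L \<le> 1 \<longrightarrow>
              (\<exists>C\<ge>0. \<forall>x y a xs.
                 nesterov_iteration (penalty f A b \<epsilon>) \<alpha> x0 x y a \<longrightarrow>
                 (\<forall>z. penalty f A b \<epsilon> xs \<le> penalty f A b \<epsilon> z) \<longrightarrow>
                 (xs \<in> D \<and> (\<forall>k. y k \<in> D)) \<or> convex_on UNIV (penalty f A b \<epsilon>) \<longrightarrow>
                 (\<forall>k. penalty f A b \<epsilon> (x k) - penalty f A b \<epsilon> xs \<le> C / (real k + 1)\<^sup>2)))"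
proof (intro allI impI, elim conjE)
  fix \<epsilon> :: real assume \<epsilon>: "0 < \<epsilon>" "ereal \<epsilon> \<le> eps_bar f A b D"
  have f: "f differentiable (at x)" and f2: "gradient f differentiable (at x)"
    and f3: "hessian f differentiable (at x)" for x
    using f_diff f_diff2 f_diff3 by (simp_all add: differentiable_on_def)
  define g where "g = penalty f A b \<epsilon>"
  have g: "g differentiable (at x)" for x
    using penalty_has_derivative[OF A_rank f f2 hessian_symmetric[OF f_convex f f2 f3]]
    unfolding g_def differentiable_def by blast
  have cvx: "convex_on D g"
    unfolding g_def using penalty_convex[OF f_convex f f2 f3 D_convex A_rank _ \<epsilon>] pos_def by blast
  have "\<exists>C\<ge>0. \<forall>x y a xs. nesterov_iteration g \<alpha> x0 x y a \<longrightarrow> (\<forall>z. g xs \<le> g z) \<longrightarrow>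
      (xs \<in> D \<and> (\<forall>k. y k \<in> D)) \<or> convex_on UNIV g \<longrightarrow>
      (\<forall>k. g (x k) - g xs \<le> C / (real k + 1)\<^sup>2)"
    if lip: "L-lipschitz_on UNIV (gradient g)" and \<alpha>: "0 < \<alpha>" "\<alpha> * L \<le> 1" for L \<alpha> x0
  \<comment> \<open>A constant obtained from one admissible minimizer serves for all of them.\<close>
  proof (cases "\<exists>x y a xs. nesterov_iteration g \<alpha> x0 x y a \<and> (\<forall>z. g xs \<le> g z) \<and>
      ((xs \<in> D \<and> (\<forall>k. y k \<in> D)) \<or> convex_on UNIV g)")
    case True
    then obtain x y a xs where iter: "nesterov_iteration g \<alpha> x0 x y a" and min: "\<And>z. g xs \<le> g z"
      and dom: "(xs \<in> D \<and> (\<forall>k. y k \<in> D)) \<or> convex_on UNIV g"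
      by blast
    define C where "C = max (2 / \<alpha> * (norm (x0 - xs))\<^sup>2) (g x0 - g xs)"
    have "0 \<le> C"
      using min[of x0] by (simp add: C_def)
    moreover have "g (x k) - g xs \<le> C / (real k + 1)\<^sup>2" for k
      unfolding C_def using dom nesterov_iteration_rate[OF g lip \<alpha> iter cvx]
        nesterov_iteration_rate[OF g lip \<alpha> iter, of UNIV]
      by blast
    moreover have "x' = x" if "nesterov_iteration g \<alpha> x0 x' y' a'" for x' y' a'
      using nesterov_iteration_unique[OF that iter] by simp
    moreover have "g xs' = g xs" if "\<forall>z. g xs' \<le> g z" for xs'
      using that min by (simp add: order_antisym)
    ultimately show ?thesis
      by metis
  next
    case False
    then show ?thesis
      by (intro exI[of _ 0]) blast
  qed
  then show "convex_on D (penalty f A b \<epsilon>) \<and>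
      (\<forall>L \<alpha> x0. L-lipschitz_on UNIV (gradient (penalty f A b \<epsilon>)) \<and> 0 < \<alpha> \<and> \<alpha> * L \<le> 1 \<longrightarrow>
        (\<exists>C\<ge>0. \<forall>x y a xs.
           nesterov_iteration (penalty f A b \<epsilon>) \<alpha> x0 x y a \<longrightarrow>
           (\<forall>z. penalty f A b \<epsilon> xs \<le> penalty f A b \<epsilon> z) \<longrightarrow>
           (xs \<in> D \<and> (\<forall>k. y k \<in> D)) \<or> convex_on UNIV (penalty f A b \<epsilon>) \<longrightarrow>
           (\<forall>k. penalty f A b \<epsilon> (x k) - penalty f A b \<epsilon> xs \<le> C / (real k + 1)\<^sup>2)))"
    using cvx unfolding g_def by blast
qed

end
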